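(* Let $P_\theta=N(\theta,1)$ for $\theta\in\mathbb{R}$ and suppose $n\ge 100$. For any $\alpha\in(0,1/4)$ there exists a constant $c>0$ depending only on $\alpha$ such that $$r_\alpha(\epsilon,[0,0.05])\ \ge\ c\left(\frac{1}{\sqrt{\log n}}+\frac{1}{\sqrt{\log(1/\epsilon)}}\right)\quad\text{for any }\epsilon\in[0,0.05].$$
   Context: For $\epsilon\in[0,1]$, $\theta\in\mathbb{R}$ and an arbitrary probability distribution $Q$ on $\mathbb{R}$, let $P_{\epsilon,\theta,Q}=(1-\epsilon)P_\theta+\epsilon Q$ (Huber's contamination model). The data are $X_1,\ldots,X_n\overset{iid}{\sim}P_{\epsilon,\theta,Q}$, and $P_{\epsilon,\theta,Q}(\cdot)$ applied to an event about the data denotes the probability under this i.i.d. sampling. A (data-dependent) interval is $\widehat{\mathrm{CI}}=[l(X_1,\ldots,X_n),u(X_1,\ldots,X_n)]$, regarded as empty if $u<l$; $|\widehat{\mathrm{CI}}|$ is its length (Lebesgue measure). For $\mathcal{E}\subset[0,1]$ and $\alpha\in(0,1)$, let $$\mathcal{I}_\alpha(\mathcal{E})=\left\{\widehat{\mathrm{CI}}=[l,u]:\ \inf_{\epsilon\in\mathcal{E}}\inf_{\theta,Q}P_{\epsilon,\theta,Q}(\theta\in\widehat{\mathrm{CI}})\ge 1-\alpha\right\},$$ and for $\epsilon\in\mathcal{E}$ let $$r_\alpha(\epsilon,\mathcal{E})=\inf\left\{r\ge 0:\ \inf_{\widehat{\mathrm{CI}}\in\mathcal{I}_\alpha(\mathcal{E})}\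 \sup_{\theta,Q}P_{\epsilon,\theta,Q}\big(|\widehat{\mathrm{CI}}|\ge r\big)\le\alpha\right\}.$$ Convention: $1/\sqrt{\log(1/\epsilon)}=0$ when $\epsilon=0$. *)

theory Defs
  imports "HOL-Probability.Probability"
begin

definition huber_mix :: "(real \<Rightarrow> real measure) \<Rightarrow> real \<Rightarrow> real \<Rightarrow> real measure \<Rightarrow> real measure" where
  "huber_mix P \<epsilon> \<theta> Q =
     measure_of UNIV (sets borel)
       (\<lambda>A. ennreal (1 - \<epsilon>) * emeasure (P \<theta>) A + ennreal \<epsilon> * emeasure Q A)"

lemma sets_huber_mix [simp, measurable_cong]: "sets (huber_mix P \<epsilon> \<theta> Q) = sets borel"
  unfolding huber_mix_def using sets.sets_measure_of_eq[of "borel :: real measure"] by simp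

lemma space_huber_mix [simp]: "space (huber_mix P \<epsilon> \<theta> Q) = UNIV"
  by (simp add: huber_mix_def)

lemma emeasure_huber_mix:
  assumes P: "sets (P \<theta>) = sets borel" and Q: "sets Q = sets borel" and A: "A \<in> sets borel"
  shows "emeasure (huber_mix P \<epsilon> \<theta> Q) A =
           ennreal (1 - \<epsilon>) * emeasure (P \<theta>) A + ennreal \<epsilon> * emeasure Q A"
proof (rule emeasure_measure_of[OF huber_mix_def])
  show "sets borel \<subseteq> Pow UNIV" by simp
  show "A \<in> sets (huber_mix P \<epsilon> \<theta> Q)" using A by simp
  let ?\<mu> = "\<lambda>A. ennreal (1 - \<epsilon>) * emeasure (P \<theta>) A + ennreal \<epsilon> * emeasure Q A"
  show "positive (sets (huber_mix P \<epsilon> \<theta> Q)) ?\<mu>" by (simp add: positive_def)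
  show "countably_additive (sets (huber_mix P \<epsilon> \<theta> Q)) ?\<mu>"
  proof (rule countably_additiveI)
    fix F :: "nat \<Rightarrow> real set"
    assume F: "range F \<subseteq> sets (huber_mix P \<epsilon> \<theta> Q)" and dis: "disjoint_family F"
    have "(\<Sum>i. emeasure (P \<theta>) (F i)) = emeasure (P \<theta>) (\<Union>i. F i)"
      using F dis P by (intro suminf_emeasure) auto
    moreover have "(\<Sum>i. emeasure Q (F i)) = emeasure Q (\<Union>i. F i)"
      using F dis Q by (intro suminf_emeasure) auto
    ultimately show "(\<Sum>i. ?\<mu> (F i)) = ?\<mu> (\<Union>i. F i)"
      by (simp flip: suminf_add)
  qed
qed

lemma prob_space_huber_mix:
  assumes "0 \<le> \<epsilon>" "\<epsilon> \<le> 1"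
    and "prob_space (P \<theta>)" "sets (P \<theta>) = sets borel"
    and "prob_space Q" "sets Q = sets borel"
  shows "prob_space (huber_mix P \<epsilon> \<theta> Q)"
proof
  have "space (P \<theta>) = UNIV" "space Q = UNIV"
    using sets_eq_imp_space_eq[OF assms(4)] sets_eq_imp_space_eq[OF assms(6)] by simp_all
  then have "emeasure (P \<theta>) UNIV = 1" "emeasure Q UNIV = 1"
    using prob_space.emeasure_space_1[OF assms(3)] prob_space.emeasure_space_1[OF assms(5)]
    by simp_all
  then show "emeasure (huber_mix P \<epsilon> \<theta> Q) (space (huber_mix P \<epsilon> \<theta> Q)) = 1"
    using assms by (simp add: emeasure_huber_mix flip: ennreal_plus)
qed

definition huber_sample ::
    "(real \<Rightarrow> real measure) \<Rightarrow> nat \<Rightarrow> real \<Rightarrow> real \<Rightarrow> real measure \<Rightarrow> (nat \<Rightarrow> real) measure" where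
  "huber_sample P n \<epsilon> \<theta> Q = (\<Pi>\<^sub>M i\<in>{..<n}. huber_mix P \<epsilon> \<theta> Q)"

text \<open>An interval \<open>[l, u]\<close> is represented by the pair \<open>(l, u)\<close> of its endpoint statistics;
  the set \<open>{l x..u x}\<close> is empty if \<open>u x < l x\<close>.\<close>

type_synonym interval_stat = "((nat \<Rightarrow> real) \<Rightarrow> real) \<times> ((nat \<Rightarrow> real) \<Rightarrow> real)"

definition ci_set :: "interval_stat \<Rightarrow> (nat \<Rightarrow> real) \<Rightarrow> real set" where
  "ci_set C x = {fst C x..snd C x}"

text \<open>All infima below are taken in \<^typ>\<open>ennreal\<close>, so that an infimum over the empty set is
  \<open>\<infinity>\<close>. For \<open>n\<close> fixed and \<open>\<alpha>\<close> very small the class of valid intervals is in fact empty.\<close>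

definition valid_ci :: "(real \<Rightarrow> real measure) \<Rightarrow> nat \<Rightarrow> real \<Rightarrow> real set \<Rightarrow> interval_stat set" where
  "valid_ci P n \<alpha> E =
     {C. fst C \<in> borel_measurable (\<Pi>\<^sub>M i\<in>{..<n}. borel) \<and>
         snd C \<in> borel_measurable (\<Pi>\<^sub>M i\<in>{..<n}. borel) \<and>
         ennreal (1 - \<alpha>) \<le>
           (INF \<epsilon>\<in>E. INF (\<theta>, Q)\<in>UNIV \<times> space (prob_algebra borel).
              emeasure (huber_sample P n \<epsilon> \<theta> Q)
                {x \<in> space (huber_sample P n \<epsilon> \<theta> Q). \<theta> \<in> ci_set C x})}"

definition ci_rate :: "(real \<Rightarrow> real measure) \<Rightarrow> nat \<Rightarrow> real \<Rightarrow> real \<Rightarrow> real set \<Rightarrow> ennreal" where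
  "ci_rate P n \<alpha> \<epsilon> E =
     Inf {ennreal r | r. 0 \<le> r \<and>
       (INF C\<in>valid_ci P n \<alpha> E. SUP (\<theta>, Q)\<in>UNIV \<times> space (prob_algebra borel).
          emeasure (huber_sample P n \<epsilon> \<theta> Q)
            {x \<in> space (huber_sample P n \<epsilon> \<theta> Q). r \<le> measure lborel (ci_set C x)})
       \<le> ennreal \<alpha>}"

definition gauss :: "real \<Rightarrow> real measure" where
  "gauss \<theta> = density lborel (normal_density \<theta> 1)"

definition inv_sqrt_log_inv :: "real \<Rightarrow> real" where
  "inv_sqrt_log_inv \<epsilon> = (if \<epsilon> = 0 then 0 else 1 / sqrt (ln (1 / \<epsilon>)))"

end

theory Submission
  imports Defs
begin

text \<open>
  Put \<open>\<eta> = max \<epsilon> (1 / (16 n))\<close> and \<open>r = 1 / (100 sqrt (ln (1 / \<eta>)))\<close>.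
  A contamination of mass \<open>\<eta> / 2\<close> at a normal law with a far mean \<open>b\<close> is enough to dominate the
  right tail of \<open>N(r, 1)\<close>: pointwise
  \<open>0.95 \<phi>(x - r) \<le> (1 - \<eta> / 2) \<phi>(x) + (\<eta> / 2) \<phi>(x - b)\<close>.
  Hence the right-hand side is at the same time a Huber mixture around \<open>0\<close> at level \<open>\<eta>\<close> and a
  Huber mixture around \<open>r\<close> at level \<open>0.05\<close>. Since the former dominates \<open>1 - 1 / (16 n)\<close> times
  the mixture at level \<open>\<epsilon>\<close>, a valid interval must contain both \<open>0\<close> and \<open>r\<close> with
  probability at least \<open>1 - \<alpha> - 16 \<alpha> / 15\<close> at level \<open>\<epsilon>\<close>, and this exceeds \<open>\<alpha>\<close>.
\<close>

section \<open>Domination of product measures\<close>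

text \<open>By Fubini the factor \<open>N\<close> can be exchanged for \<open>M\<close> one
  coordinate at a time, each exchange costing one factor \<open>c\<close>.\<close>

lemma nn_integral_PiM_scaled_mono:
  fixes M N :: "'a measure" and c :: ennreal
  assumes M: "prob_space M" and N: "prob_space N"
    and sets_eq: "sets M = sets N"
    and dom: "\<And>A. A \<in> sets N \<Longrightarrow> c * emeasure N A \<le> emeasure M A"
    and "finite I" and "f \<in> borel_measurable (PiM I (\<lambda>_. N))"
  shows "c ^ card I * (\<integral>\<^sup>+ x. f x \<partial>PiM I (\<lambda>_. N)) \<le> (\<integral>\<^sup>+ x. f x \<partial>PiM I (\<lambda>_. M))"
  using assms(5,6)
proof (induction I arbitrary: f rule: finite_induct)
  case empty
  interpret M: prob_space M by fact
  interpret N: prob_space N by fact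
  interpret PM: product_sigma_finite "\<lambda>_. M" by standard
  interpret PN: product_sigma_finite "\<lambda>_. N" by standard
  show ?case
    by (simp add: PM.nn_integral_empty PN.nn_integral_empty)
next
  case (insert i I)
  interpret M: prob_space M by fact
  interpret N: prob_space N by fact
  interpret PM: product_sigma_finite "\<lambda>_. M" by standard
  interpret PN: product_sigma_finite "\<lambda>_. N" by standard
  have sets_PiM_eq: "sets (PiM J (\<lambda>_. M)) = sets (PiM J (\<lambda>_. N))" for J :: "'b set"
    by (intro sets_PiM_cong) (auto simp: sets_eq)
  note f [measurable] = insert.prems
  have f_M: "f \<in> borel_measurable (PiM (insert i I) (\<lambda>_. M))"
    using f by (simp cong: measurable_cong_sets add: sets_PiM_eq)
  have le: "scale_measure c N \<le> M"
    using dom by (intro le_measure[THEN iffD2]) (auto simp: sets_eq le_fun_def)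
  have inner: "c * (\<integral>\<^sup>+ y. f (x(i := y)) \<partial>N) \<le> (\<integral>\<^sup>+ y. f (x(i := y)) \<partial>M)"
    if x [measurable]: "x \<in> space (PiM I (\<lambda>_. N))" for x
  proof -
    have "(\<lambda>y. f (x(i := y))) \<in> borel_measurable N" by measurable
    then have "c * (\<integral>\<^sup>+ y. f (x(i := y)) \<partial>N) = (\<integral>\<^sup>+ y. f (x(i := y)) \<partial>scale_measure c N)"
      by (simp add: nn_integral_scale_measure)
    also have "\<dots> \<le> (\<integral>\<^sup>+ y. f (x(i := y)) \<partial>M)"
      by (intro nn_integral_mono_measure le) (simp add: sets_eq)
    finally show ?thesis .
  qed
  have meas_N: "(\<lambda>x. \<integral>\<^sup>+ y. f (x(i := y)) \<partial>N) \<in> borel_measurable (PiM I (\<lambda>_. N))"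
    by measurable
  have "c ^ card (insert i I) * (\<integral>\<^sup>+ x. f x \<partial>PiM (insert i I) (\<lambda>_. N))
      = c ^ card I * (c * (\<integral>\<^sup>+ x. (\<integral>\<^sup>+ y. f (x(i := y)) \<partial>N) \<partial>PiM I (\<lambda>_. N)))"
    using insert.hyps f by (simp add: PN.product_nn_integral_insert ac_simps)
  also have "\<dots> = c ^ card I * (\<integral>\<^sup>+ x. c * (\<integral>\<^sup>+ y. f (x(i := y)) \<partial>N) \<partial>PiM I (\<lambda>_. N))"
    by (simp add: nn_integral_cmult[OF meas_N])
  \<comment> \<open>The induction hypothesis is applied to \<open>c\<close> times the inner integral
    over \<open>N\<close>; the new coordinate is exchanged afterwards, by
    \<open>inner\<close>.\<close>
  also have "\<dots> \<le> (\<integral>\<^sup>+ x. c * (\<integral>\<^sup>+ y. f (x(i := y)) \<partial>N) \<partial>PiM I (\<lambda>_. M))"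
    by (intro insert.IH borel_measurable_times_ennreal borel_measurable_const meas_N)
  also have "\<dots> \<le> (\<integral>\<^sup>+ x. (\<integral>\<^sup>+ y. f (x(i := y)) \<partial>M) \<partial>PiM I (\<lambda>_. M))"
    using sets_eq_imp_space_eq[OF sets_PiM_eq[of I]]
    by (intro nn_integral_mono inner) simp
  also have "\<dots> = (\<integral>\<^sup>+ x. f x \<partial>PiM (insert i I) (\<lambda>_. M))"
    using insert.hyps f_M by (simp add: PM.product_nn_integral_insert)
  finally show ?case .
qed

lemma emeasure_PiM_scaled_mono:
  fixes M N :: "'a measure" and c :: ennreal
  assumes "prob_space M" and "prob_space N"
    and sets_eq: "sets M = sets N"
    and "\<And>A. A \<in> sets N \<Longrightarrow> c * emeasure N A \<le> emeasure M A"
    and "finite I" and A: "A \<in> sets (PiM I (\<lambda>_. N))"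
  shows "c ^ card I * emeasure (PiM I (\<lambda>_. N)) A \<le> emeasure (PiM I (\<lambda>_. M)) A"
proof -
  have "sets (PiM I (\<lambda>_. M)) = sets (PiM I (\<lambda>_. N))"
    by (intro sets_PiM_cong) (auto simp: sets_eq)
  with nn_integral_PiM_scaled_mono[OF assms(1-5), of "indicator A"] A show ?thesis
    by simp
qed

section \<open>Densities and comparison of Huber mixtures\<close>

lemma huber_mix_density:
  assumes P: "P \<theta> = density lborel (\<lambda>x. ennreal (f x))"
    and [measurable]: "f \<in> borel_measurable borel" "g \<in> borel_measurable borel"
    and "\<And>x. 0 \<le> f x" "\<And>x. 0 \<le> g x" "0 \<le> \<epsilon>" "\<epsilon> \<le> 1"
  shows "huber_mix P \<epsilon> \<theta> (density lborel (\<lambda>x. ennreal (g x)))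
    = density lborel (\<lambda>x. ennreal ((1 - \<epsilon>) * f x + \<epsilon> * g x))"
proof (rule measure_eqI)
  fix A assume "A \<in> sets (huber_mix P \<epsilon> \<theta> (density lborel (\<lambda>x. ennreal (g x))))"
  then have A [measurable]: "A \<in> sets borel" by simp
  have "ennreal ((1 - \<epsilon>) * f x + \<epsilon> * g x) * indicator A x
      = ennreal (1 - \<epsilon>) * (ennreal (f x) * indicator A x)
        + ennreal \<epsilon> * (ennreal (g x) * indicator A x)" for x
    using assms(4-) by (simp add: ennreal_mult indicator_def)
  then show "emeasure (huber_mix P \<epsilon> \<theta> (density lborel (\<lambda>x. ennreal (g x)))) A
      = emeasure (density lborel (\<lambda>x. ennreal ((1 - \<epsilon>) * f x + \<epsilon> * g x))) A"
    by (simp add: emeasure_huber_mix P emeasure_density nn_integral_add nn_integral_cmult)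
qed simp

text \<open>With the same \<open>Q\<close> on both sides, it is enough to compare the two weights
  separately. This passes from level \<epsilon> to the larger level \<eta>.\<close>

lemma huber_mix_scaled_mono:
  assumes P: "sets (P \<theta>) = sets borel" and Q: "sets Q = sets borel" and A: "A \<in> sets borel"
    and k: "0 \<le> k" "k * (1 - \<epsilon>) \<le> 1 - \<eta>" "k * \<epsilon> \<le> \<eta>" and "0 \<le> \<epsilon>" "\<epsilon> \<le> 1"
  shows "ennreal k * emeasure (huber_mix P \<epsilon> \<theta> Q) A \<le> emeasure (huber_mix P \<eta> \<theta> Q) A"
proof -
  have "ennreal k * emeasure (huber_mix P \<epsilon> \<theta> Q) A
      = ennreal (k * (1 - \<epsilon>)) * emeasure (P \<theta>) A + ennreal (k * \<epsilon>) * emeasure Q A"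
    using assms by (simp add: emeasure_huber_mix distrib_left ennreal_mult mult.assoc)
  also have "\<dots> \<le> ennreal (1 - \<eta>) * emeasure (P \<theta>) A + ennreal \<eta> * emeasure Q A"
    using k by (intro add_mono mult_right_mono ennreal_leI) auto
  also have "\<dots> = emeasure (huber_mix P \<eta> \<theta> Q) A"
    using assms by (simp add: emeasure_huber_mix)
  finally show ?thesis .
qed

section \<open>One law with two Gaussian centres\<close>

lemma density_in_prob_algebra:
  assumes "integrable lborel g" and "\<And>x. 0 \<le> g x" and "(\<integral>x. g x \<partial>lborel) = 1"
  shows "density lborel (\<lambda>x. ennreal (g x)) \<in> space (prob_algebra borel)"
proof -
  have [measurable]: "g \<in> borel_measurable lborel" using assms(1) by auto
  have "prob_space (density lborel (\<lambda>x. ennreal (g x)))"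
    using assms by (intro prob_spaceI) (simp add: emeasure_density nn_integral_eq_integral)
  then show ?thesis by (simp add: space_prob_algebra)
qed

text \<open>
  With \<open>u\<close> the log-likelihood ratio of \<open>N(r, 1)\<close> to \<open>N(0, 1)\<close>, the first component dominates where
  \<open>exp u \<le> 39 / 38 = (1 - 0.05 / 2) / 0.95\<close>. Elsewhere \<open>u \<ge> ln (39 / 38) \<ge> 1 / 39\<close>, and the factor
  \<open>117 = 3 * 39\<close> makes the density of \<open>N(b, 1)\<close> at least \<open>1 / \<eta>\<^sup>2\<close> times that of \<open>N(r, 1)\<close>.
\<close>

lemma normal_density_le_mixture:
  assumes \<eta>: "0 < \<eta>" "\<eta> \<le> 0.05"
  defines "L \<equiv> ln (1 / \<eta>)"
  defines "r \<equiv> 1 / (100 * sqrt L)"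
  defines "b \<equiv> (1 + 117 * L) * r"
  shows "0.95 * normal_density r 1 x
    \<le> (1 - \<eta> / 2) * normal_density 0 1 x + \<eta> / 2 * normal_density b 1 x"
proof -
  have "exp 1 \<le> (1 / \<eta> :: real)"
  proof -
    have "exp (1::real) \<le> 3" by (rule exp_le)
    also have "3 \<le> 1 / \<eta>" using \<eta> by (simp add: field_simps)
    finally show ?thesis .
  qed
  then have L: "1 \<le> L"
    using \<eta> unfolding L_def by (subst ln_ge_iff) auto
  \<comment> \<open>The scale of \<open>r\<close> is chosen so that this product is a small
    constant, whatever \<eta> is.\<close>
  have r2: "L * r\<^sup>2 = 1 / 10000"
    using L by (simp add: r_def power_divide power_mult_distrib)
  have shift: "normal_density m 1 x = exp (m * x - m\<^sup>2 / 2) * normal_density 0 1 x" for m :: real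
    by (simp add: normal_density_def mult.commute power2_eq_square algebra_simps
        diff_divide_distrib add_divide_distrib flip: exp_add)
  define u where "u = r * x - r\<^sup>2 / 2"
  show ?thesis
  proof (cases "exp u \<le> 39 / 38")
    case True
    have "0.95 * normal_density r 1 x = (0.95 * exp u) * normal_density 0 1 x"
      by (simp add: shift[of r] u_def)
    also have "\<dots> \<le> (1 - \<eta> / 2) * normal_density 0 1 x"
      using True \<eta> by (intro mult_right_mono) auto
    also have "\<dots> \<le> (1 - \<eta> / 2) * normal_density 0 1 x + \<eta> / 2 * normal_density b 1 x"
      using \<eta> by simp
    finally show ?thesis .
  next
    case False
    \<comment> \<open>The bound \<open>ln y \<le> y - 1\<close> is used at the reciprocal
      38/39.\<close>
    have "1 / 39 \<le> ln (39 / 38 :: real)"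
      using ln_le_minus_one[of "38/39::real"]
      by (simp add: ln_div)
    also have "\<dots> \<le> u"
      using False by (metis exp_gt_zero less_le not_le ln_less_cancel_iff ln_exp zero_less_divide_iff zero_less_numeral)
    finally have u: "1 / 39 \<le> u" .
    have "(1 + 117 * L) * r\<^sup>2 \<le> 118 * L * r\<^sup>2"
      using L by (intro mult_right_mono) auto
    then have r2': "(1 + 117 * L) * r\<^sup>2 \<le> 118 / 10000"
      using r2 by simp
    have "b * x - b\<^sup>2 / 2 = u + 117 * L * (u - (1 + 117 * L) * r\<^sup>2 / 2)"
      by (simp add: b_def u_def power2_eq_square field_simps)
    \<comment> \<open>Here \<open>u\<close> is at least 3/117, while the subtracted term is at most
      59/10000 < 1/117.\<close>
    moreover have "117 * L * (2 / 117) \<le> 117 * L * (u - (1 + 117 * L) * r\<^sup>2 / 2)"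
      using L u r2' by (intro mult_left_mono) auto
    ultimately have "u + 2 * L \<le> b * x - b\<^sup>2 / 2" by simp
    then have "exp (u + 2 * L) \<le> exp (b * x - b\<^sup>2 / 2)" by simp
    moreover have "exp (u + 2 * L) = exp u * (1 / \<eta>)\<^sup>2"
      using \<eta> by (simp add: L_def exp_add exp_double)
    ultimately have "\<eta> / 2 * (exp u * (1 / \<eta>)\<^sup>2) \<le> \<eta> / 2 * exp (b * x - b\<^sup>2 / 2)"
      using \<eta> by (intro mult_left_mono) auto
    \<comment> \<open>The weight \<eta>/2 leaves the factor 1/(2 \<eta>), which is at least
      1.\<close>
    moreover have "exp u \<le> \<eta> / 2 * (exp u * (1 / \<eta>)\<^sup>2)"
      using \<eta> by (simp add: power2_eq_square field_simps)
    ultimately have "exp u \<le> \<eta> / 2 * exp (b * x - b\<^sup>2 / 2)"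
      by linarith
    then have "exp u * normal_density 0 1 x \<le> \<eta> / 2 * exp (b * x - b\<^sup>2 / 2) * normal_density 0 1 x"
      by (intro mult_right_mono) auto
    then have "normal_density r 1 x \<le> \<eta> / 2 * normal_density b 1 x"
      by (simp add: shift[of r] shift[of b] u_def mult.assoc)
    moreover have "0 \<le> (1 - \<eta> / 2) * normal_density 0 1 x"
      using \<eta> by simp
    moreover have "0.95 * normal_density r 1 x \<le> normal_density r 1 x"
      by (intro mult_left_le_one_le) auto
    ultimately show ?thesis by linarith
  qed
qed

text \<open>\<open>Q\<close> splits its mass equally between N(0,1) and N(b,1), which gives the
  right-hand side of \<open>normal_density_le_mixture\<close>. \<open>Q'\<close> is the excess over
  0.95 N(r,1), divided by 0.05; that inequality makes its density nonnegative.\<close>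

lemma huber_mix_gauss_eq:
  assumes \<eta>: "0 < \<eta>" "\<eta> \<le> 0.05"
  obtains Q Q' where "Q \<in> space (prob_algebra borel)" "Q' \<in> space (prob_algebra borel)"
    "huber_mix gauss \<eta> 0 Q = huber_mix gauss 0.05 (1 / (100 * sqrt (ln (1 / \<eta>)))) Q'"
proof -
  define r where "r = 1 / (100 * sqrt (ln (1 / \<eta>)))"
  define b where "b = (1 + 117 * ln (1 / \<eta>)) * r"
  define q where "q x = (normal_density 0 1 x + normal_density b 1 x) / 2" for x
  define q' where "q' x = ((1 - \<eta> / 2) * normal_density 0 1 x + \<eta> / 2 * normal_density b 1 x
    - 0.95 * normal_density r 1 x) / 0.05" for x
  have q'_nonneg: "0 \<le> q' x" for x
    using normal_density_le_mixture[OF \<eta>, of x] by (simp add: q'_def r_def b_def)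
  have q_nonneg: "0 \<le> q x" for x by (simp add: q_def)
  have [measurable]: "q \<in> borel_measurable borel" "q' \<in> borel_measurable borel"
    by (simp_all add: q_def[abs_def] q'_def[abs_def])
  have Q: "density lborel (\<lambda>x. ennreal (q x)) \<in> space (prob_algebra borel)"
    by (rule density_in_prob_algebra) (auto simp: q_def)
  have Q': "density lborel (\<lambda>x. ennreal (q' x)) \<in> space (prob_algebra borel)"
    using q'_nonneg by (intro density_in_prob_algebra) (auto simp: q'_def)
  have "(1 - \<eta>) * normal_density 0 1 x + \<eta> * q x
      = (1 - 0.05) * normal_density r 1 x + 0.05 * q' x" for x
    by (simp add: q_def q'_def field_simps)
  then have "huber_mix gauss \<eta> 0 (density lborel (\<lambda>x. ennreal (q x)))
      = huber_mix gauss 0.05 r (density lborel (\<lambda>x. ennreal (q' x)))"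
    using \<eta> q_nonneg q'_nonneg
    by (subst (1 2) huber_mix_density[OF gauss_def]) auto
  with Q Q' that show thesis by (simp add: r_def)
qed

section \<open>Valid intervals are long\<close>

lemma valid_ci_covers:
  assumes "C \<in> valid_ci P n \<alpha> E" and "\<epsilon> \<in> E" and "Q \<in> space (prob_algebra borel)"
  shows "ennreal (1 - \<alpha>) \<le> emeasure (huber_sample P n \<epsilon> \<theta> Q)
    {x \<in> space (huber_sample P n \<epsilon> \<theta> Q). \<theta> \<in> ci_set C x}"
proof -
  have "ennreal (1 - \<alpha>) \<le> (INF \<epsilon>\<in>E. INF (\<theta>, Q)\<in>UNIV \<times> space (prob_algebra borel).
      emeasure (huber_sample P n \<epsilon> \<theta> Q)
        {x \<in> space (huber_sample P n \<epsilon> \<theta> Q). \<theta> \<in> ci_set C x})"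
    using assms(1) by (simp add: valid_ci_def)
  also have "\<dots> \<le> (INF (\<theta>, Q)\<in>UNIV \<times> space (prob_algebra borel).
      emeasure (huber_sample P n \<epsilon> \<theta> Q)
        {x \<in> space (huber_sample P n \<epsilon> \<theta> Q). \<theta> \<in> ci_set C x})"
    by (intro INF_lower assms(2))
  also have "\<dots> \<le> emeasure (huber_sample P n \<epsilon> \<theta> Q)
        {x \<in> space (huber_sample P n \<epsilon> \<theta> Q). \<theta> \<in> ci_set C x}"
    by (rule INF_lower2[of "(\<theta>, Q)"]) (use assms(3) in auto)
  finally show ?thesis .
qed

lemma prob_space_gauss: "prob_space (gauss \<theta>)"
  unfolding gauss_def by (rule prob_space_normal_density) simp

lemma sets_gauss [simp]: "sets (gauss \<theta>) = sets borel"
  by (simp add: gauss_def)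

text \<open>Coverage of 0 is available at level \<epsilon> itself; coverage of \<open>r\<close>
  holds under the common law \<open>M\<close> and is carried back to \<open>N\<close> through the
  probability of missing \<open>r\<close>. The margin 1/5 comes from \<alpha> < 1/4: then 1 -
  \<alpha> - 16 \<alpha>/15 exceeds \<alpha> + 1/5.\<close>

lemma valid_ci_long:
  assumes \<alpha>: "0 < \<alpha>" "\<alpha> < 1/4" and n: "100 \<le> n" and \<epsilon>: "\<epsilon> \<in> {0..0.05}"
    and C: "C \<in> valid_ci gauss n \<alpha> {0..0.05}"
  defines "\<eta> \<equiv> max \<epsilon> (1 / (16 * real n))"
  defines "r \<equiv> 1 / (100 * sqrt (ln (1 / \<eta>)))"
  assumes r': "r' \<le> r"
  obtains Q where "Q \<in> space (prob_algebra borel)"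
    "ennreal (\<alpha> + 1 / 5) \<le> emeasure (huber_sample gauss n \<epsilon> 0 Q)
      {x \<in> space (huber_sample gauss n \<epsilon> 0 Q). r' \<le> measure lborel (ci_set C x)}"
proof -
  have n_inv: "0 < 1 / (16 * real n)" "1 / (16 * real n) \<le> 0.05"
    using n by (auto simp: field_simps)
  have \<eta>: "0 < \<eta>" "\<eta> \<le> 0.05"
    unfolding \<eta>_def less_max_iff_disj max.bounded_iff using n_inv \<epsilon> by auto
  obtain Q Q' where Q: "Q \<in> space (prob_algebra borel)" and Q': "Q' \<in> space (prob_algebra borel)"
    and eq: "huber_mix gauss \<eta> 0 Q = huber_mix gauss 0.05 r Q'"
    using huber_mix_gauss_eq[OF \<eta>] unfolding r_def by blast
  have Q_prob: "prob_space Q" "sets Q = sets borel"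
    using Q by (auto simp: space_prob_algebra)
  \<comment> \<open>\<open>k\<close> is the price per observation. In the case \<eta> = 1/(16 n) it
    equals 1 - \<eta>; in the case \<eta> = \<epsilon> any factor in [0, 1] would do.\<close>
  define k where "k = 1 - 1 / (16 * real n)"
  define N where "N = huber_mix gauss \<epsilon> 0 Q"
  define M where "M = huber_mix gauss \<eta> 0 Q"
  interpret N: prob_space N
    unfolding N_def using \<epsilon> Q_prob by (intro prob_space_huber_mix prob_space_gauss) auto
  interpret M: prob_space M
    unfolding M_def using \<eta> Q_prob by (intro prob_space_huber_mix prob_space_gauss) auto
  interpret S: product_prob_space "\<lambda>_. N" "{..<n}" by standard
  interpret T: product_prob_space "\<lambda>_. M" "{..<n}" by standard
  have sets_N: "sets N = sets borel" and sets_M: "sets M = sets borel"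
    by (simp_all add: N_def M_def)
  have sets_S: "sets (PiM {..<n} (\<lambda>_. N)) = sets (PiM {..<n} (\<lambda>_. borel))"
    and sets_T: "sets (PiM {..<n} (\<lambda>_. M)) = sets (PiM {..<n} (\<lambda>_. borel))"
    by (intro sets_PiM_cong; simp add: sets_N sets_M)+
  note space_S = sets_eq_imp_space_eq[OF sets_S]
  note space_T = sets_eq_imp_space_eq[OF sets_T]
  let ?B = "PiM {..<n} (\<lambda>_. borel) :: (nat \<Rightarrow> real) measure"
  have [measurable]: "fst C \<in> borel_measurable ?B" "snd C \<in> borel_measurable ?B"
    using C by (auto simp: valid_ci_def)
  define A0 where "A0 = {x \<in> space ?B. 0 \<in> ci_set C x}"
  define Ar where "Ar = {x \<in> space ?B. r \<in> ci_set C x}"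
  have A0: "A0 \<in> sets ?B" and Ar: "Ar \<in> sets ?B"
    unfolding A0_def Ar_def ci_set_def atLeastAtMost_iff by measurable
  have cover0: "1 - \<alpha> \<le> S.prob A0"
    using valid_ci_covers[OF C \<epsilon> Q, of 0] \<alpha>
    by (simp add: huber_sample_def space_S A0_def S.emeasure_eq_measure flip: N_def)
  \<comment> \<open>\<open>M\<close> is read here as a mixture around \<open>r\<close> at level
    0.05, the largest level at which validity is assumed.\<close>
  have coverr: "1 - \<alpha> \<le> T.prob Ar"
    using valid_ci_covers[OF C _ Q', of "0.05" r, unfolded huber_sample_def, folded eq M_def] \<alpha>
    by (simp add: space_T Ar_def T.emeasure_eq_measure)
  have k: "0 \<le> k" "k \<le> 1" using n_inv by (auto simp: k_def)
  have k_dom: "k * (1 - \<epsilon>) \<le> 1 - \<eta>" "k * \<epsilon> \<le> \<eta>"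
  proof -
    show "k * \<epsilon> \<le> \<eta>"
      using mult_right_mono[OF k(2), of \<epsilon>] \<epsilon> by (simp add: \<eta>_def)
    show "k * (1 - \<epsilon>) \<le> 1 - \<eta>"
      using mult_right_mono[OF k(2), of "1 - \<epsilon>"] mult_left_mono[OF _ k(1), of "1 - \<epsilon>" 1] \<epsilon>
      by (auto simp: \<eta>_def max_def k_def)
  qed
  \<comment> \<open>By Bernoulli's inequality the total loss over \<open>n\<close> observations
    stays bounded; this is why the floor for \<eta> is of order 1/n.\<close>
  have "15 / 16 = 1 + real n * (- (1 / (16 * real n)))"
    using n by simp
  also have "\<dots> \<le> k ^ n"
    using Bernoulli_inequality[of "- (1 / (16 * real n))" n] n_inv by (simp add: k_def)
  finally have k_pow: "15 / 16 \<le> k ^ n" .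
  have "ennreal k ^ card {..<n} * emeasure (PiM {..<n} (\<lambda>_. N)) (space ?B - Ar)
      \<le> emeasure (PiM {..<n} (\<lambda>_. M)) (space ?B - Ar)"
  proof (rule emeasure_PiM_scaled_mono)
    show "ennreal k * emeasure N A \<le> emeasure M A" if "A \<in> sets N" for A
      unfolding N_def M_def using that sets_N Q_prob k k_dom \<epsilon>
      by (intro huber_mix_scaled_mono) auto
    show "space ?B - Ar \<in> sets (PiM {..<n} (\<lambda>_. N))"
      using Ar by (simp add: sets_S)
  qed (auto simp: sets_N sets_M N.prob_space_axioms M.prob_space_axioms)
  then have "k ^ n * S.prob (space ?B - Ar) \<le> T.prob (space ?B - Ar)"
    using k by (simp add: S.emeasure_eq_measure T.emeasure_eq_measure ennreal_power
        flip: ennreal_mult)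
  also have "\<dots> \<le> \<alpha>"
    using T.prob_compl[of Ar] Ar coverr by (simp add: sets_T space_T)
  finally have "k ^ n * S.prob (space ?B - Ar) \<le> \<alpha>" .
  moreover have "15 / 16 * S.prob (space ?B - Ar) \<le> k ^ n * S.prob (space ?B - Ar)"
    using k_pow by (intro mult_right_mono) auto
  ultimately have miss: "S.prob (space ?B - Ar) \<le> 16 / 15 * \<alpha>" by simp
  have "A0 \<subseteq> (A0 \<inter> Ar) \<union> (space ?B - Ar)" by (auto simp: A0_def)
  then have "S.prob A0 \<le> S.prob ((A0 \<inter> Ar) \<union> (space ?B - Ar))"
    using A0 Ar by (intro S.finite_measure_mono) (auto simp: sets_S)
  also have "\<dots> \<le> S.prob (A0 \<inter> Ar) + S.prob (space ?B - Ar)"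
    using A0 Ar by (intro measure_Un_le) (auto simp: sets_S)
  finally have both: "\<alpha> + 1 / 5 \<le> S.prob (A0 \<inter> Ar)"
    using cover0 miss \<alpha> by simp
  let ?W = "{x \<in> space ?B. r' \<le> measure lborel (ci_set C x)}"
  \<comment> \<open>The maximum accounts for empty intervals, which have length 0.\<close>
  have len: "measure lborel (ci_set C x) = max 0 (snd C x - fst C x)" for x
    by (simp add: ci_set_def max_def)
  have "?W \<in> sets ?B" unfolding len by measurable
  moreover have "A0 \<inter> Ar \<subseteq> ?W"
    unfolding len using r' by (auto simp: A0_def Ar_def ci_set_def)
  ultimately have "S.prob (A0 \<inter> Ar) \<le> S.prob ?W"
    by (intro S.finite_measure_mono) (auto simp: sets_S)
  with both have "ennreal (\<alpha> + 1 / 5) \<le> emeasure (PiM {..<n} (\<lambda>_. N)) ?W"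
    by (simp add: S.emeasure_eq_measure)
  with that[OF Q] show thesis
    by (simp add: huber_sample_def space_S flip: N_def)
qed

section \<open>The lower bound for the rate\<close>

theorem theorem1:
  fixes \<alpha> :: real
  assumes "0 < \<alpha>" and "\<alpha> < 1/4"
  shows "\<exists>c::real. 0 < c \<and>
    (\<forall>n::nat. 100 \<le> n \<longrightarrow>
      (\<forall>\<epsilon>\<in>{0..0.05}.
        ennreal (c * (1 / sqrt (ln (real n)) + inv_sqrt_log_inv \<epsilon>))
          \<le> ci_rate gauss n \<alpha> \<epsilon> {0..0.05}))"
\<comment> \<open>The two summands are bounded by 200 \<open>r\<close> and 100 \<open>r\<close>,
  hence the constant 1/300.\<close>
proof (intro exI[of _ "1 / 300"] conjI allI impI ballI)
  fix n :: nat and \<epsilon> :: real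
  assume n: "100 \<le> n" and \<epsilon>: "\<epsilon> \<in> {0..0.05}"
  define \<eta> where "\<eta> = max \<epsilon> (1 / (16 * real n))"
  define r where "r = 1 / (100 * sqrt (ln (1 / \<eta>)))"
  have "0 < 1 / (16 * real n)" "1 / (16 * real n) \<le> 0.05"
    using n by (auto simp: field_simps)
  then have \<eta>: "0 < \<eta>" "\<eta> \<le> 0.05" "1 / (16 * real n) \<le> \<eta>" "\<epsilon> \<le> \<eta>"
    unfolding \<eta>_def less_max_iff_disj max.bounded_iff using \<epsilon> by auto
  have L: "0 < ln (1 / \<eta>)" using \<eta> by simp
  have "inv_sqrt_log_inv \<epsilon> \<le> 100 * r"
  proof (cases "\<epsilon> = 0")
    case True
    then show ?thesis using L by (simp add: inv_sqrt_log_inv_def r_def)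
  next
    case False
    then have "0 < \<epsilon>" using \<epsilon> by simp
    then have "ln (1 / \<eta>) \<le> ln (1 / \<epsilon>)"
      using \<eta> by (subst ln_le_cancel_iff) (auto simp: field_simps)
    then show ?thesis
      using L False by (simp add: inv_sqrt_log_inv_def r_def frac_le)
  qed
  moreover have "1 / sqrt (ln (real n)) \<le> 200 * r"
  proof -
    have "1 / \<eta> \<le> 16 * real n"
      using \<eta> n by (simp add: field_simps)
    \<comment> \<open>A power of \<open>n\<close> turns the factor 16 into a multiple of
      \<open>ln n\<close>; the exponent 4 becomes a factor 2 under the square root.\<close>
    also have "\<dots> \<le> real n ^ 4"
    proof -
      have "16 * real n \<le> real n ^ 3 * real n"
        using n power_mono[of 100 "real n" 3] by (intro mult_right_mono) auto
      then show ?thesis by (simp add: power_Suc2 eval_nat_numeral mult_ac)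
    qed
    finally have "ln (1 / \<eta>) \<le> ln (real n ^ 4)"
      using \<eta> n by (subst ln_le_cancel_iff) auto
    then have "ln (1 / \<eta>) \<le> 4 * ln (real n)"
      using n by (simp add: ln_realpow)
    then have "sqrt (ln (1 / \<eta>)) \<le> 2 * sqrt (ln (real n))"
      using real_sqrt_le_mono[of "ln (1 / \<eta>)" "4 * ln (real n)"] by (simp add: real_sqrt_mult)
    then show ?thesis
      using L n by (simp add: r_def field_simps)
  qed
  ultimately have bound: "1 / 300 * (1 / sqrt (ln (real n)) + inv_sqrt_log_inv \<epsilon>) \<le> r"
    by simp
  have "ennreal r \<le> ci_rate gauss n \<alpha> \<epsilon> {0..0.05}"
    unfolding ci_rate_def
  proof (rule Inf_greatest, clarify)
    fix r' :: real
    assume "0 \<le> r'" and small: "(INF C\<in>valid_ci gauss n \<alpha> {0..0.05}.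
        SUP (\<theta>, Q)\<in>UNIV \<times> space (prob_algebra borel).
          emeasure (huber_sample gauss n \<epsilon> \<theta> Q)
            {x \<in> space (huber_sample gauss n \<epsilon> \<theta> Q). r' \<le> measure lborel (ci_set C x)})
        \<le> ennreal \<alpha>"
    show "ennreal r \<le> ennreal r'"
    proof (rule ccontr)
      assume "\<not> ?thesis"
      then have "r' < r" using ennreal_leI[of r r'] by linarith
      \<comment> \<open>A margin that is the same for all \<open>C\<close> keeps the infimum
        strictly above \<alpha>. An empty class is covered too, its infimum being infinite.\<close>
      have "ennreal (\<alpha> + 1 / 5) \<le> (INF C\<in>valid_ci gauss n \<alpha> {0..0.05}.
        SUP (\<theta>, Q)\<in>UNIV \<times> space (prob_algebra borel).
          emeasure (huber_sample gauss n \<epsilon> \<theta> Q)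
            {x \<in> space (huber_sample gauss n \<epsilon> \<theta> Q). r' \<le> measure lborel (ci_set C x)})"
      proof (rule INF_greatest)
        fix C assume C: "C \<in> valid_ci gauss n \<alpha> {0..0.05}"
        obtain Q where Q: "Q \<in> space (prob_algebra borel)" and
          long: "ennreal (\<alpha> + 1 / 5) \<le> emeasure (huber_sample gauss n \<epsilon> 0 Q)
            {x \<in> space (huber_sample gauss n \<epsilon> 0 Q). r' \<le> measure lborel (ci_set C x)}"
          using valid_ci_long[OF assms n \<epsilon> C, of r'] \<open>r' < r\<close> unfolding r_def \<eta>_def by auto
        note long
        also have "\<dots> \<le> (SUP (\<theta>, Q)\<in>UNIV \<times> space (prob_algebra borel).
          emeasure (huber_sample gauss n \<epsilon> \<theta> Q)
            {x \<in> space (huber_sample gauss n \<epsilon> \<theta> Q). r' \<le> measure lborel (ci_set C x)})"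
          by (rule SUP_upper2[of "(0, Q)"]) (use Q in auto)
        finally show "ennreal (\<alpha> + 1 / 5) \<le> \<dots>" .
      qed
      also note small
      finally show False using assms by simp
    qed
  qed
  with bound show "ennreal (1 / 300 * (1 / sqrt (ln (real n)) + inv_sqrt_log_inv \<epsilon>))
      \<le> ci_rate gauss n \<alpha> \<epsilon> {0..0.05}"
    by (meson ennreal_leI order_trans)
qed simp

end
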